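(* Every (randomized) algorithm that, given {\textsc{COND-PR}} access to an unknown distribution $D$ on $[n]$ and a parameter $\epsilon \in (0,1]$, outputs an estimate $\hat{s}$ of the support size $|\mathrm{supp}(D)|$ within a multiplicative $(1+\epsilon)$-factor with probability at least $2/3$, must make $\Omega\!\left(\log\log n + \frac{1}{\epsilon^2\log(1/\epsilon)}\right)$ queries to the {\textsc{COND-PR}} oracle.
   Context: $[n]=\{1,\dots,n\}$. For a distribution $D$ on $[n]$ and $S\subseteq[n]$, $D(S)=\sum_{i\in S}D(i)$, and $\mathrm{supp}(D)=\{x: D(x)>0\}$. A {\textsc{COND-PR}} (probability-revealing conditional sampling) oracle for $D$ takes as input any set $S\subseteq[n]$ chosen (possibly adaptively) by the algorithm; if $D(S)>0$ it returns the pair $(j,D(j))$ for $j\in S$ drawn with probability $D(j)/D(S)$, and if $D(S)=0$ it returns "failure". An estimate $\hat{s}$ is within a multiplicative $(1+\epsilon)$-factor if $|\mathrm{supp}(D)|/(1+\epsilon)\le \hat{s}\le (1+\epsilon)|\mathrm{supp}(D)|$. The probability is over the algorithm's randomness and the oracle's answers, and the guarantee must hold for every distribution $D$ on $[n]$.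
   Formalization: The bound is proved for n large and 1/ε² ≤ n, with log(1/ε) read as max(1, log(1/ε)); as literally stated it fails for ε→0 at fixed n and for ε→1, since n singleton queries always determine the support, and it is undefined at ε=1. *)

theory Defs
  imports "HOL-Probability.Probability"
begin

definition dists_on :: "nat \<Rightarrow> nat pmf set" where
  "dists_on n = {D. set_pmf D \<subseteq> {1..n}}"

text \<open>The answer \<^term>\<open>None\<close> stands for ``failure''.\<close>

type_synonym answer = "(nat \<times> real) option"

definition cond_pr :: "nat pmf \<Rightarrow> nat set \<Rightarrow> answer pmf" where
  "cond_pr D S =
     (if measure_pmf.prob D S > 0
      then map_pmf (\<lambda>j. Some (j, pmf D j)) (cond_pmf D S)
      else return_pmf None)"

text \<open>A deterministic adaptive algorithm is a decision tree: either it halts with an estimate,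
  or it queries a set and continues depending on the answer of the oracle.\<close>

datatype det_alg = Output real | Query "nat set" "answer \<Rightarrow> det_alg"

primrec queries_subsets_of :: "nat set \<Rightarrow> det_alg \<Rightarrow> bool" where
  "queries_subsets_of U (Output s) \<longleftrightarrow> True"
| "queries_subsets_of U (Query S k) \<longleftrightarrow> S \<subseteq> U \<and> (\<forall>a. queries_subsets_of U (k a))"

text \<open>Joint distribution, over the oracle's answers, of the output and the number of queries.\<close>

primrec run :: "nat pmf \<Rightarrow> det_alg \<Rightarrow> (real \<times> nat) pmf" where
  "run D (Output s) = return_pmf (s, 0)"
| "run D (Query S k) =
     bind_pmf (cond_pr D S) (\<lambda>a. map_pmf (\<lambda>(s, m). (s, Suc m)) (run D (k a)))"

text \<open>A randomized algorithm is a probability distribution over deterministic ones.  The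
  underlying \<open>\<sigma>\<close>-algebra is arbitrary, so that every kind of internal randomness is covered
  (any random seed can be pushed forward to the tree that it selects).\<close>

definition randomized_alg :: "nat \<Rightarrow> det_alg measure \<Rightarrow> bool" where
  "randomized_alg n A \<longleftrightarrow> prob_space A \<and> (\<forall>t\<in>space A. queries_subsets_of {1..n} t)"

definition within_factor :: "real \<Rightarrow> nat pmf \<Rightarrow> real \<Rightarrow> bool" where
  "within_factor \<epsilon> D s \<longleftrightarrow>
     real (card (set_pmf D)) / (1 + \<epsilon>) \<le> s \<and> s \<le> (1 + \<epsilon>) * real (card (set_pmf D))"

text \<open>The probability is over the choice of the tree and the oracle's answers.  If the success
  probability of the tree is not measurable in the tree, then the integral is 0 by convention, so
  a positive lower bound on it includes measurability.\<close>

definition success_prob :: "real \<Rightarrow> nat pmf \<Rightarrow> det_alg measure \<Rightarrow> real" where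
  "success_prob \<epsilon> D A =
     (\<integral>t. measure_pmf.prob (run D t) {(s, m). within_factor \<epsilon> D s} \<partial>A)"

definition estimates_support :: "nat \<Rightarrow> real \<Rightarrow> det_alg measure \<Rightarrow> bool" where
  "estimates_support n \<epsilon> A \<longleftrightarrow> (\<forall>D\<in>dists_on n. success_prob \<epsilon> D A \<ge> 2 / 3)"

text \<open>Worst-case query bound: over all inputs and all runs of positive probability.\<close>

definition queries_at_most :: "nat \<Rightarrow> nat \<Rightarrow> det_alg measure \<Rightarrow> bool" where
  "queries_at_most n q A \<longleftrightarrow>
     (\<forall>D\<in>dists_on n. AE t in A. \<forall>(s, m)\<in>set_pmf (run D t). m \<le> q)"

text \<open>The bound \<open>log log n + 1 / (\<epsilon>\<^sup>2 log (1/\<epsilon>))\<close>.  As \<open>log (1/\<epsilon>)\<close> tends to 0 for \<open>\<epsilon> \<rightarrow> 1\<close>, it is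
  read as at least 1; this only concerns \<open>\<epsilon> > 1/2\<close>.  The bound is meant
  for \<open>1/\<epsilon>\<^sup>2 \<le> n\<close>: querying all singletons determines the support with \<open>n\<close> queries for every \<open>\<epsilon>\<close>,
  so without a relation between \<open>\<epsilon>\<close> and \<open>n\<close> it cannot hold.\<close>

definition query_bound :: "nat \<Rightarrow> real \<Rightarrow> real" where
  "query_bound n \<epsilon> = log 2 (log 2 (real n)) + 1 / (\<epsilon>\<^sup>2 * max 1 (log 2 (1 / \<epsilon>)))"

end

theory Submission
  imports Defs
begin

text \<open>
  Choose distributions whose weights decrease by a tiny ratio \<open>r\<close> along the support, so that a
  query \<open>S\<close> is answered, up to an error \<open>r\<close>, by the least support element in \<open>S\<close>.  Each element
  also carries the mass that the gap up to the next support element would have had; hence the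
  weights always sum to 1, and a revealed weight discloses only the next support element.  By
  averaging, it suffices to consider a deterministic tree that receives least-element answers.

  For the \<open>log log n\<close> term, the supports are the initial segments \<open>{1..8\<^sup>k}\<close>: a query essentially
  compares \<open>k\<close> with a number, so \<open>q\<close> queries identify the right one of at most \<open>2\<^sup>q\<^sup>+\<^sup>1\<close> values
  of \<open>k\<close>.

  For the \<open>\<epsilon>\<close> term, the support contains \<open>2i+1\<close> for all \<open>i < m\<close>, and \<open>2i+2\<close> if the \<open>i\<close>-th of \<open>m\<close>
  independent bits is 1.  The bits have bias \<open>1/2\<close> or \<open>1/2 + d\<close> with \<open>d = 24 \<epsilon>\<close>, which the
  algorithm has to distinguish.  The chi-square divergence of what it sees grows by a factor of at
  most \<open>1 + 8 d\<^sup>2\<close> per query, which gives \<open>q = \<Omega>(1/\<epsilon>\<^sup>2)\<close>, even without the logarithm.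
\<close>

section \<open>Geometric weights rounded down to a support\<close>

definition trunc_geom :: "real \<Rightarrow> nat set \<Rightarrow> nat pmf" where
  "trunc_geom r T = map_pmf (\<lambda>g. Max {t\<in>T. t \<le> Suc g}) (geometric_pmf (1 - r))"

lemma Max_le_Suc:
  assumes "1 \<in> (T::nat set)"
  shows "Max {t\<in>T. t \<le> Suc g} \<in> T" "Max {t\<in>T. t \<le> Suc g} \<le> Suc g"
    "\<And>t. t \<in> T \<Longrightarrow> t \<le> Suc g \<Longrightarrow> t \<le> Max {t\<in>T. t \<le> Suc g}"
proof -
  have fin: "finite {t\<in>T. t \<le> Suc g}" by simp
  have "{t\<in>T. t \<le> Suc g} \<noteq> {}" using assms by auto
  from Max_in[OF fin this]
  show "Max {t\<in>T. t \<le> Suc g} \<in> T" "Max {t\<in>T. t \<le> Suc g} \<le> Suc g" by auto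
  show "\<And>t. t \<in> T \<Longrightarrow> t \<le> Suc g \<Longrightarrow> t \<le> Max {t\<in>T. t \<le> Suc g}"
    using fin by simp
qed

lemma Max_le_Suc_eq_iff:
  assumes "1 \<in> (T::nat set)" "j \<in> T"
  shows "Max {t\<in>T. t \<le> Suc g} = j \<longleftrightarrow> j \<le> Suc g \<and> \<not> (\<exists>t\<in>T. j < t \<and> t \<le> Suc g)"
proof
  assume "Max {t\<in>T. t \<le> Suc g} = j"
  then show "j \<le> Suc g \<and> \<not> (\<exists>t\<in>T. j < t \<and> t \<le> Suc g)"
    using Max_le_Suc(2,3)[OF assms(1), of g] by (auto simp: not_less)
next
  assume j: "j \<le> Suc g \<and> \<not> (\<exists>t\<in>T. j < t \<and> t \<le> Suc g)"
  then have "j \<le> Max {t\<in>T. t \<le> Suc g}" using Max_le_Suc(3)[OF assms] by blast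
  moreover have "\<not> j < Max {t\<in>T. t \<le> Suc g}"
    using j Max_le_Suc(1,2)[OF assms(1), of g] by blast
  ultimately show "Max {t\<in>T. t \<le> Suc g} = j" by linarith
qed

lemma set_trunc_geom:
  assumes "0 < r" "r < 1" "1 \<in> T" "\<And>t. t \<in> T \<Longrightarrow> 1 \<le> t"
  shows "set_pmf (trunc_geom r T) = T"
proof -
  have "set_pmf (geometric_pmf (1 - r)) = UNIV"
    using assms(1,2) by (simp add: set_pmf_geometric)
  moreover have "range (\<lambda>g. Max {t\<in>T. t \<le> Suc g}) = T"
  proof (intro equalityI subsetI)
    fix t assume t: "t \<in> T"
    then have "Max {u\<in>T. u \<le> Suc (t - 1)} = t"
      using Max_le_Suc_eq_iff[OF assms(3) t, of "t - 1"] assms(4)[OF t] by auto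
    then show "t \<in> range (\<lambda>g. Max {t\<in>T. t \<le> Suc g})"
      by (intro image_eqI[of _ _ "t - 1"]) simp_all
  qed (use Max_le_Suc(1)[OF assms(3)] in auto)
  ultimately show ?thesis by (simp add: trunc_geom_def)
qed

text \<open>The mass at \<open>j\<close> is that of the gap up to the next element. The last
  assumption says that this next element is the same in both sets; quantifying over thresholds
  \<open>g\<close> also covers the case that there is none.\<close>

lemma pmf_trunc_geom_cong:
  assumes "1 \<in> T" "1 \<in> T'" "j \<in> T" "j \<in> T'"
    and "\<And>g. (\<exists>t\<in>T. j < t \<and> t \<le> g) \<longleftrightarrow> (\<exists>t\<in>T'. j < t \<and> t \<le> g)"
  shows "pmf (trunc_geom r T) j = pmf (trunc_geom r T') j"
proof -
  have "(\<lambda>g. Max {t\<in>T. t \<le> Suc g}) -` {j} = (\<lambda>g. Max {t\<in>T'. t \<le> Suc g}) -` {j}"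
    unfolding set_eq_iff vimage_singleton_eq Max_le_Suc_eq_iff[OF assms(1,3)]
      Max_le_Suc_eq_iff[OF assms(2,4)] using assms(5) by blast
  then show ?thesis by (simp add: trunc_geom_def pmf_map)
qed

lemma measure_geometric_atLeast:
  assumes "0 \<le> r" "r < 1"
  shows "measure_pmf.prob (geometric_pmf (1 - r)) {j..} = r ^ j"
proof -
  have "measure_pmf.prob (geometric_pmf (1 - r)) {..<j} = (\<Sum>i<j. r ^ i * (1 - r))"
    using assms by (simp add: measure_measure_pmf_finite)
  also have "\<dots> = 1 - r ^ j"
    by (induction j) (auto simp: algebra_simps)
  finally show ?thesis
    using measure_pmf.prob_compl[of "{..<j}" "geometric_pmf (1 - r)"]
    by (simp add: Compl_eq_Diff_UNIV[symmetric])
qed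

lemma measure_trunc_geom_atLeast:
  assumes "0 \<le> r" "r < 1" "1 \<in> T" "j \<in> T"
  shows "measure_pmf.prob (trunc_geom r T) {j..} = r ^ (j - 1)"
proof -
  have "(\<lambda>g. Max {t\<in>T. t \<le> Suc g}) -` {j..} = {j - 1..}"
  proof (intro set_eqI iffI)
    fix g assume "g \<in> (\<lambda>g. Max {t\<in>T. t \<le> Suc g}) -` {j..}"
    then show "g \<in> {j - 1..}" using Max_le_Suc(2)[OF assms(3), of g] by auto
  next
    fix g assume "g \<in> {j - 1..}"
    then show "g \<in> (\<lambda>g. Max {t\<in>T. t \<le> Suc g}) -` {j..}"
      using Max_le_Suc(3)[OF assms(3,4), of g] by auto
  qed
  then show ?thesis
    using measure_geometric_atLeast[OF assms(1,2)] by (simp add: trunc_geom_def)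
qed

text \<open>Only an inequality, because rounding down can push values of \<open>Suc g\<close> above
  \<open>j\<close> back to \<open>j\<close> or below.\<close>

lemma measure_trunc_geom_greaterThan:
  assumes "0 \<le> r" "r < 1" "1 \<in> T"
  shows "measure_pmf.prob (trunc_geom r T) {j<..} \<le> r ^ j"
proof -
  have "(\<lambda>g. Max {t\<in>T. t \<le> Suc g}) -` {j<..} \<subseteq> {j..}"
  proof
    fix g assume "g \<in> (\<lambda>g. Max {t\<in>T. t \<le> Suc g}) -` {j<..}"
    then show "g \<in> {j..}" using Max_le_Suc(2)[OF assms(3), of g] by auto
  qed
  from measure_pmf.finite_measure_mono[OF this, of "geometric_pmf (1 - r)"] show ?thesis
    using measure_geometric_atLeast[OF assms(1,2), of j] by (simp add: trunc_geom_def)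
qed

section \<open>Replacing the oracle by its least-element answers\<close>

definition least_answer :: "nat pmf \<Rightarrow> nat set \<Rightarrow> answer" where
  "least_answer D S = (if S \<inter> set_pmf D = {} then None
     else Some (LEAST j. j \<in> S \<inter> set_pmf D, pmf D (LEAST j. j \<in> S \<inter> set_pmf D)))"

lemma least_answer_eq_None: "S \<inter> set_pmf D = {} \<Longrightarrow> least_answer D S = None"
  by (simp add: least_answer_def)

lemma least_answer_eq_Some:
  assumes "j \<in> S" "j \<in> set_pmf D" "\<And>i. i \<in> S \<Longrightarrow> i \<in> set_pmf D \<Longrightarrow> j \<le> i"
  shows "least_answer D S = Some (j, pmf D j)"
proof -
  have "(LEAST j. j \<in> S \<inter> set_pmf D) = j"
    by (rule Least_equality) (use assms in auto)
  then show ?thesis using assms(1,2) by (auto simp: least_answer_def)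
qed

lemma cond_pr_least_answer:
  "least_answer D S \<in> set_pmf (cond_pr D S)"
proof (cases "S \<inter> set_pmf D = {}")
  case True
  then have "measure_pmf.prob D S = 0" by (simp add: measure_pmf_zero_iff Int_commute)
  then show ?thesis by (simp add: cond_pr_def least_answer_eq_None True)
next
  case False
  then have pos: "measure_pmf.prob D S > 0"
    by (metis Int_commute measure_pmf_zero_iff zero_less_measure_iff)
  define j where "j = (LEAST j. j \<in> S \<inter> set_pmf D)"
  have "j \<in> S \<inter> set_pmf D" unfolding j_def by (rule LeastI_ex) (use False in auto)
  then show ?thesis using pos False
    unfolding least_answer_def j_def[symmetric]
    by (auto simp: cond_pr_def set_cond_pmf Int_commute)
qed

text \<open>If \<open>j\<close> is the least support element in \<open>S\<close>, all of
  \<open>S\<close> lies in the tail from \<open>j\<close>, of mass \<open>r ^ (j - 1)\<close>. The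
  part beyond \<open>j\<close> has mass at most \<open>r ^ j\<close>, so \<open>j\<close> has at
  least the share \<open>1 - r\<close>.\<close>

lemma cond_pr_trunc_geom:
  assumes "0 < r" "r < 1" "1 \<in> T" "\<And>t. t \<in> T \<Longrightarrow> 1 \<le> t"
  shows "measure_pmf.prob (cond_pr (trunc_geom r T) S)
    (- {least_answer (trunc_geom r T) S}) \<le> r"
proof (cases "S \<inter> T = {}")
  case True
  then have "measure_pmf.prob (trunc_geom r T) S = 0"
    by (simp add: measure_pmf_zero_iff set_trunc_geom[OF assms] Int_commute)
  then show ?thesis
    using assms(1) by (simp add: cond_pr_def least_answer_eq_None set_trunc_geom[OF assms] True)
next
  case False
  let ?D = "trunc_geom r T"
  let ?P = "measure_pmf.prob ?D"
  note set = set_trunc_geom[OF assms]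
  have ne: "set_pmf ?D \<inter> S \<noteq> {}" using False set by auto
  have pos: "?P S > 0"
    using ne by (metis measure_pmf_zero_iff zero_less_measure_iff)
  define j where "j = (LEAST j. j \<in> S \<inter> T)"
  have j: "j \<in> S" "j \<in> T" 
    using LeastI_ex[of "\<lambda>j. j \<in> S \<inter> T"] False unfolding j_def by auto
  have least: "j \<le> i" if "i \<in> S" "i \<in> T" for i
    unfolding j_def by (rule Least_le) (use that in auto)
  have ans: "least_answer ?D S = Some (j, pmf ?D j)"
    by (rule least_answer_eq_Some) (use j least set in auto)
  have "measure_pmf.prob (cond_pr ?D S) {Some (j, pmf ?D j)} = pmf (cond_pmf ?D S) j"
  proof -
    have "(\<lambda>j. Some (j, pmf ?D j)) -` {Some (j, pmf ?D j)} = {j}" by auto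
    then show ?thesis using pos by (simp add: cond_pr_def measure_pmf_single pmf_map)
  qed
  also have "\<dots> = pmf ?D j / ?P S"
    using j by (simp add: pmf_cond[OF ne])
  finally have eq: "measure_pmf.prob (cond_pr ?D S) (- {least_answer ?D S}) = 1 - pmf ?D j / ?P S"
    using measure_pmf.prob_compl[of "{Some (j, pmf ?D j)}" "cond_pr ?D S"]
    by (simp add: ans Compl_eq_Diff_UNIV)
  have "?P S \<le> pmf ?D j + ?P {j<..}"
  proof -
    have "?P S = ?P (S \<inter> T)"
      by (metis measure_Int_set_pmf set)
    also have "\<dots> \<le> ?P ({j} \<union> {j<..})"
      by (rule measure_pmf.finite_measure_mono) (use least in force)+
    also have "\<dots> = ?P {j} + ?P {j<..}"
      by (rule measure_pmf.finite_measure_Union) auto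
    finally show ?thesis by (simp add: measure_pmf_single)
  qed
  moreover have "?P {j..} = pmf ?D j + ?P {j<..}"
  proof -
    have "?P {j..} = ?P ({j} \<union> {j<..})" by (rule arg_cong[of _ _ ?P]) auto
    also have "\<dots> = ?P {j} + ?P {j<..}"
      by (rule measure_pmf.finite_measure_Union) auto
    finally show ?thesis by (simp add: measure_pmf_single)
  qed
  moreover have "?P {j..} = r ^ (j - 1)"
    using measure_trunc_geom_atLeast assms j by auto
  moreover have "?P {j<..} \<le> r * r ^ (j - 1)"
    using measure_trunc_geom_greaterThan[of r T j] assms(1,2,3) assms(4)[OF j(2)]
    by (cases j) auto
  ultimately have "(1 - r) * ?P S \<le> pmf ?D j"
    using assms(1,2) mult_left_mono[of "?P S" "r ^ (j - 1)" "1 - r"] by (auto simp: algebra_simps)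
  then have "1 - r \<le> pmf ?D j / ?P S" using pos by (simp add: field_simps)
  then show ?thesis using eq by simp
qed

primrec least_output :: "nat pmf \<Rightarrow> det_alg \<Rightarrow> real" where
  "least_output D (Output s) = s"
| "least_output D (Query S k) = least_output D (k (least_answer D S))"

primrec least_queries :: "nat pmf \<Rightarrow> det_alg \<Rightarrow> nat" where
  "least_queries D (Output s) = 0"
| "least_queries D (Query S k) = Suc (least_queries D (k (least_answer D S)))"

text \<open>This run has positive probability, so a worst-case bound on the queries also bounds
  \<open>least_queries\<close>.\<close>

lemma least_run_in_run: "(least_output D t, least_queries D t) \<in> set_pmf (run D t)"
proof (induction t)
  case (Query S k)
  let ?a = "least_answer D S"
  have "(\<lambda>(s, m). (s, Suc m)) (least_output D (k ?a), least_queries D (k ?a))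
      \<in> (\<lambda>(s, m). (s, Suc m)) ` set_pmf (run D (k ?a))"
    by (intro imageI Query) simp
  then show ?case using cond_pr_least_answer[of D S] by auto
qed simp

lemma prob_bind_le:
  "measure_pmf.prob (bind_pmf p f) B \<le> measure_pmf.prob p (- {a}) + measure_pmf.prob (f a) B"
proof -
  have "emeasure (bind_pmf p f) B = (\<integral>\<^sup>+ x. emeasure (f x) B \<partial>p)" by simp
  also have "\<dots> \<le> (\<integral>\<^sup>+ x. indicator (- {a}) x + emeasure (f a) B \<partial>p)"
    by (intro nn_integral_mono) (auto simp: indicator_def measure_pmf.emeasure_le_1
        intro: order_trans[OF measure_pmf.emeasure_le_1])
  also have "\<dots> = emeasure p (- {a}) + emeasure (f a) B"
    by (simp add: nn_integral_add)
  finally show ?thesis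
    by (simp add: measure_pmf.emeasure_eq_measure flip: ennreal_plus)
qed

text \<open>Union bound along the path of least answers: each query leaves the path with probability
  at most \<open>r\<close>, and a run that has left it is counted as satisfying
  \<open>P\<close>.\<close>

lemma run_trunc_geom_le:
  assumes "0 < r" "r < 1" "1 \<in> T" "\<And>t. t \<in> T \<Longrightarrow> 1 \<le> t"
  shows "measure_pmf.prob (run (trunc_geom r T) t) {(s, m). P s} \<le>
    of_bool (P (least_output (trunc_geom r T) t)) + r * real (least_queries (trunc_geom r T) t)"
proof (induction t)
  case (Query S k)
  let ?D = "trunc_geom r T"
  let ?a = "least_answer ?D S"
  have "(\<lambda>(s, m). (s, Suc m)) -` {(s, m). P s} = {(s, m). P s}" by auto
  then have "measure_pmf.prob (run ?D (Query S k)) {(s, m). P s} \<le>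
      measure_pmf.prob (cond_pr ?D S) (- {?a}) + measure_pmf.prob (run ?D (k ?a)) {(s, m). P s}"
    using prob_bind_le[of "cond_pr ?D S" "\<lambda>a. map_pmf (\<lambda>(s, m). (s, Suc m)) (run ?D (k a))"
        "{(s, m). P s}" ?a] by simp
  then show ?case
    using Query[OF rangeI[of k ?a]] cond_pr_trunc_geom[OF assms, of S] by (simp add: algebra_simps)
qed simp

section \<open>Averaging over the randomness of the algorithm\<close>

text \<open>The easy direction of Yao's principle, with \<open>c\<close> as an unnormalized prior on
  the inputs. The success rate drops from 2/3 to 33/50 in choosing a tree, and by another 1/100 to
  13/20 in passing to least answers.\<close>

lemma good_tree_exists:
  fixes T :: "'i \<Rightarrow> nat set" and c :: "'i \<Rightarrow> real"
  assumes "randomized_alg n A" "estimates_support n \<epsilon> A" "queries_at_most n q A"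
    and r: "0 < r" "r < 1" "r * real q \<le> 1 / 100"
    and I: "finite I" "\<And>i. i \<in> I \<Longrightarrow> 0 \<le> c i"
    and T: "\<And>i. i \<in> I \<Longrightarrow> 1 \<in> T i" "\<And>i. i \<in> I \<Longrightarrow> T i \<subseteq> {1..n}"
  obtains t where "\<And>i. i \<in> I \<Longrightarrow> least_queries (trunc_geom r (T i)) t \<le> q"
    "(\<Sum>i\<in>I. c i) * (13 / 20) \<le>
     (\<Sum>i\<in>I. c i * of_bool (within_factor \<epsilon> (trunc_geom r (T i)) (least_output (trunc_geom r (T i)) t)))"
proof -
  interpret prob_space A using assms(1) by (simp add: randomized_alg_def)
  define D where "D i = trunc_geom r (T i)" for i
  define f where "f t = (\<Sum>i\<in>I. c i * measure_pmf.prob (run (D i) t) {(s, m). within_factor \<epsilon> (D i) s})" for t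
  have D: "D i \<in> dists_on n" if "i \<in> I" for i
    using set_trunc_geom[OF r(1,2) T(1)[OF that]] T(2)[OF that] by (force simp: D_def dists_on_def)
  have succ: "success_prob \<epsilon> (D i) A \<ge> 2 / 3" if "i \<in> I" for i
    using assms(2) D[OF that] by (simp add: estimates_support_def)
  have int: "integrable A (\<lambda>t. measure_pmf.prob (run (D i) t) {(s, m). within_factor \<epsilon> (D i) s})"
    if "i \<in> I" for i
  \<comment> \<open>A non-integrable function has integral 0 by convention, which contradicts the
    success probability 2/3.\<close>
  proof (rule ccontr)
    assume "\<not> ?thesis"
    from not_integrable_integral_eq[OF this] show False
      using succ[OF that] by (simp add: success_prob_def)
  qed
  have intf: "integrable A f" unfolding f_def
    by (intro Bochner_Integration.integrable_sum integrable_mult_right int)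
  have "(\<integral>t. f t \<partial>A) = (\<Sum>i\<in>I. c i * success_prob \<epsilon> (D i) A)"
    unfolding f_def success_prob_def
    by (subst Bochner_Integration.integral_sum) (auto intro!: integrable_mult_right int)
  also have "\<dots> \<ge> (\<Sum>i\<in>I. c i * (2 / 3))"
    by (intro sum_mono mult_left_mono succ I)
  finally have ge: "(\<Sum>i\<in>I. c i) * (2 / 3) \<le> (\<integral>t. f t \<partial>A)" by (simp only: sum_distrib_right)
  \<comment> \<open>The exceptional null set depends on the input; finitely many inputs have a
    common one.\<close>
  have ae: "AE t in A. \<forall>i\<in>I. \<forall>(s, m)\<in>set_pmf (run (D i) t). m \<le> q"
    using assms(3) D by (intro AE_finite_allI I) (auto simp: queries_at_most_def)
  \<comment> \<open>Asking for 33/50, strictly below 2/3, lets a non-strict bound on the integral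
    give the contradiction when the total weight is positive.\<close>
  have "\<exists>t. (\<forall>i\<in>I. \<forall>(s, m)\<in>set_pmf (run (D i) t). m \<le> q) \<and> (\<Sum>i\<in>I. c i) * (33 / 50) \<le> f t"
  proof (rule ccontr)
    assume neg: "\<not> ?thesis"
    have "AE t in A. f t < (\<Sum>i\<in>I. c i) * (33 / 50)"
      using ae by eventually_elim (use neg not_le in blast)
    moreover have "(\<Sum>i\<in>I. c i) \<ge> 0" using I by (simp add: sum_nonneg)
    ultimately show False
    proof (cases "(\<Sum>i\<in>I. c i) = 0")
      case True
      then have "c i = 0" if "i \<in> I" for i using I that by (simp add: sum_nonneg_eq_0_iff)
      then have "f t = 0" for t by (simp add: f_def)
      then show ?thesis using \<open>AE t in A. f t < _\<close> True by simp
    next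
      case False
      have "(\<integral>t. f t \<partial>A) \<le> (\<Sum>i\<in>I. c i) * (33 / 50)"
        by (rule integral_le_const[OF intf]) (use \<open>AE t in A. f t < _\<close> in eventually_elim, simp)
      then show ?thesis using ge False \<open>(\<Sum>i\<in>I. c i) \<ge> 0\<close> by linarith
    qed
  qed
  then obtain t where q: "\<And>i s m. i \<in> I \<Longrightarrow> (s, m) \<in> set_pmf (run (D i) t) \<Longrightarrow> m \<le> q"
    and ft: "(\<Sum>i\<in>I. c i) * (33 / 50) \<le> f t" by blast
  have lq: "least_queries (D i) t \<le> q" if "i \<in> I" for i
    using q[OF that least_run_in_run] .
  have "f t \<le> (\<Sum>i\<in>I. c i * (of_bool (within_factor \<epsilon> (D i) (least_output (D i) t)) + 1 / 100))"
    unfolding f_def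
  proof (intro sum_mono mult_left_mono I)
    fix i assume i: "i \<in> I"
    have "r * real (least_queries (D i) t) \<le> 1 / 100"
      using mult_left_mono[of "real (least_queries (D i) t)" "real q" r] lq[OF i] r by linarith
    then show "measure_pmf.prob (run (D i) t) {(s, m). within_factor \<epsilon> (D i) s}
       \<le> of_bool (within_factor \<epsilon> (D i) (least_output (D i) t)) + 1 / 100"
      using run_trunc_geom_le[OF r(1,2) T(1)[OF i], of t "within_factor \<epsilon> (D i)"] T(2)[OF i]
      by (force simp: D_def)
  qed
  also have "\<dots> = (\<Sum>i\<in>I. c i * of_bool (within_factor \<epsilon> (D i) (least_output (D i) t))) + (\<Sum>i\<in>I. c i) / 100"
    by (simp add: distrib_left sum.distrib sum_divide_distrib)
  finally show ?thesis using ft lq that[of t] by (simp add: D_def)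
qed

section \<open>The \<open>log log n\<close> term: initial segments\<close>

text \<open>As \<epsilon> is at most 1, a correct estimate is within a factor 2 of the size, and
  sizes that differ by a factor of at least 8 > 2 * 2 share no such estimate.\<close>

lemma within_factor_inj_initial_segments:
  assumes r: "0 < r" "r < 1" and \<epsilon>: "0 < \<epsilon>" "\<epsilon> \<le> 1"
    and "within_factor \<epsilon> (trunc_geom r {1..8 ^ k}) s"
    and "within_factor \<epsilon> (trunc_geom r {1..8 ^ l}) s"
  shows "k = l"
proof -
  have set: "set_pmf (trunc_geom r {1..8 ^ k}) = {1..8 ^ k}" for k :: nat
    by (rule set_trunc_geom[OF r]) auto
  have bounds: "8 ^ k / 2 \<le> s \<and> s \<le> 2 * 8 ^ k"
    if "within_factor \<epsilon> (trunc_geom r {1..8 ^ k}) s" for k :: nat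
  proof -
    have w: "8 ^ k / (1 + \<epsilon>) \<le> s" "s \<le> (1 + \<epsilon>) * 8 ^ k"
      using that unfolding within_factor_def set by simp_all
    have "8 ^ k / 2 \<le> 8 ^ k / (1 + \<epsilon>)" using \<epsilon> by (intro divide_left_mono) auto
    moreover have "(1 + \<epsilon>) * 8 ^ k \<le> 2 * 8 ^ k" using \<epsilon> by (intro mult_right_mono) auto
    ultimately show ?thesis using w by linarith
  qed
  have "\<not> k < l" if "within_factor \<epsilon> (trunc_geom r {1..8 ^ k}) s"
    "within_factor \<epsilon> (trunc_geom r {1..8 ^ l}) s" for k l
  proof
    assume "k < l"
    then have "(8::real) ^ Suc k \<le> 8 ^ l" by (intro power_increasing) auto
    moreover have "(0::real) < 8 ^ k" by simp
    ultimately show False using bounds[OF that(1)] bounds[OF that(2)] by simp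
  qed
  then show ?thesis using assms(5,6) nat_neq_iff by blast
qed

text \<open>With the least answer, a query separates the initial segments into those longer than its
  least element, which all answer alike, those shorter, which fail, and at most one of exactly
  that length.\<close>

lemma card_correct_initial_segments:
  assumes r: "0 < r" "r < 1" and \<epsilon>: "0 < \<epsilon>" "\<epsilon> \<le> 1"
    and "finite I" "\<And>k. k \<in> I \<Longrightarrow> least_queries (trunc_geom r {1..8 ^ k}) t \<le> q"
  shows "card {k\<in>I. within_factor \<epsilon> (trunc_geom r {1..8 ^ k})
    (least_output (trunc_geom r {1..8 ^ k}) t)} + 1 \<le> 2 ^ (q + 1)"
  using assms(5,6)
proof (induction t arbitrary: I q)
  case (Output s)
  let ?C = "{k\<in>I. within_factor \<epsilon> (trunc_geom r {1..8 ^ k}) s}"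
  have "card ?C \<le> Suc 0"
    using Output(1) within_factor_inj_initial_segments[OF r \<epsilon>]
    by (subst card_le_Suc0_iff_eq) auto
  moreover have "1 \<le> (2::nat) ^ q" by simp
  ultimately show ?case unfolding least_output.simps power_add power_one_right by linarith
next
  case (Query S f)
  define D where "D k = trunc_geom r {1..8 ^ k}" for k :: nat
  have set: "set_pmf (D k) = {1..8 ^ k}" for k
    unfolding D_def by (rule set_trunc_geom[OF r]) auto
  define C where "C t J = {k\<in>J. within_factor \<epsilon> (D k) (least_output (D k) t)}" for t J
  note fin = \<open>finite I\<close>
  \<comment> \<open>Indices with a common answer \<open>a\<close> all continue in
    \<open>f a\<close>, with one query less; hence the exponent \<open>q\<close> in place of
    \<open>q + 1\<close>.\<close>
  have IH: "card (C (Query S f) J) + 1 \<le> 2 ^ q"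
    if "J \<subseteq> I" and a: "\<And>k. k \<in> J \<Longrightarrow> least_answer (D k) S = a" for J a
  proof -
    have "card (C (f a) J) + 1 \<le> 2 ^ q"
    proof (cases q)
      case 0
      then have "J = {}" using Query.prems(2) \<open>J \<subseteq> I\<close> by fastforce
      then show ?thesis by (simp add: C_def)
    next
      case (Suc q')
      have "finite J" using fin \<open>J \<subseteq> I\<close> finite_subset by blast
      moreover have "least_queries (D k) (f a) \<le> q'" if "k \<in> J" for k
        using Query.prems(2)[of k] a[OF that] that \<open>J \<subseteq> I\<close> Suc by (auto simp: D_def)
      ultimately show ?thesis
        using Query.IH[OF rangeI, of J a q'] by (simp add: C_def D_def Suc)
    qed
    moreover have "C (Query S f) J = C (f a) J" using a by (auto simp: C_def)
    ultimately show ?thesis by simp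
  qed
  have "card (C (Query S f) I) + 1 \<le> 2 ^ (q + 1)"
  proof (cases "S \<inter> {1..} = {}")
    case True
    have "card (C (Query S f) I) + 1 \<le> 2 ^ q"
      by (rule IH[of _ None]) (use True set in \<open>auto intro!: least_answer_eq_None\<close>)
    then show ?thesis by simp
  next
    case False
    define j where "j = (LEAST j. j \<in> S \<inter> {1..})"
    have j: "j \<in> S" "1 \<le> j"
      using LeastI_ex[of "\<lambda>j. j \<in> S \<inter> {1..}"] False unfolding j_def by auto
    have least: "j \<le> i" if "i \<in> S" "1 \<le> i" for i
      unfolding j_def by (rule Least_le) (use that in auto)
    define L where "L = {k\<in>I. j < 8 ^ k}"
    define E where "E = {k\<in>I. j = 8 ^ k}"
    define G where "G = {k\<in>I. 8 ^ k < j}"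
    have "C (Query S f) I = C (Query S f) L \<union> C (Query S f) E \<union> C (Query S f) G"
      by (auto simp: C_def L_def E_def G_def)
    \<comment> \<open>Two groups of at most \<open>2 ^ q - 1\<close> correct indices and one of at
      most 1 add up to \<open>2 ^ (q + 1) - 1\<close>; this recursion is why the claim counts
      \<open>+ 1\<close>.\<close>
    then have "card (C (Query S f) I) \<le>
        card (C (Query S f) L) + card (C (Query S f) E) + card (C (Query S f) G)"
      using card_Un_le[of "C (Query S f) L \<union> C (Query S f) E" "C (Query S f) G"]
        card_Un_le[of "C (Query S f) L" "C (Query S f) E"] by simp
    moreover have "card (C (Query S f) E) \<le> Suc 0"
      using fin by (subst card_le_Suc0_iff_eq) (auto simp: C_def E_def)
    moreover have "card (C (Query S f) G) + 1 \<le> 2 ^ q"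
      by (rule IH[of _ None])
        (use least set in \<open>auto simp: G_def intro!: least_answer_eq_None dest!: least\<close>)
    moreover have "card (C (Query S f) L) + 1 \<le> 2 ^ q"
    proof (rule IH)
      show "L \<subseteq> I" by (auto simp: L_def)
      fix k assume k: "k \<in> L"
      then have "least_answer (D k) S = Some (j, pmf (D k) j)"
        using j least by (intro least_answer_eq_Some) (auto simp: set L_def)
      \<comment> \<open>In each longer segment the element after \<open>j\<close> is
        \<open>Suc j\<close>, so the weight is that in a reference segment independent of
        \<open>k\<close>.\<close>
      moreover have "pmf (D k) j = pmf (trunc_geom r {1..Suc j}) j"
        unfolding D_def by (rule pmf_trunc_geom_cong) (use k j in \<open>auto simp: L_def\<close>)
      ultimately show "least_answer (D k) S = Some (j, pmf (trunc_geom r {1..Suc j}) j)" by simp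
    qed
    ultimately show ?thesis by simp
  qed
  then show ?case by (simp add: C_def D_def)
qed

lemma loglog_query_lower_bound:
  assumes \<epsilon>: "0 < \<epsilon>" "\<epsilon> \<le> 1"
    and A: "randomized_alg n A" "estimates_support n \<epsilon> A" "queries_at_most n q A"
    and n: "2 \<le> n"
  shows "log 2 (log 2 (real n)) \<le> real q + 4"
proof -
  define r where "r = 1 / (100 * (real q + 1))"
  have r: "0 < r" "r < 1" "r * real q \<le> 1 / 100" by (auto simp: r_def field_simps)
  define K where "K = nat \<lfloor>log 8 (real n)\<rfloor>"
  have "0 \<le> log 8 (real n)" using n by simp
  then have K: "real K \<le> log 8 (real n)" "log 8 (real n) < real K + 1"
    unfolding K_def by linarith+
  have sub: "{1..8 ^ k} \<subseteq> {1..n}" if "k \<in> {..K}" for k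
  proof -
    have "real (8 ^ k) = 8 powr real k" by (simp add: powr_realpow)
    also have "\<dots> \<le> 8 powr log 8 (real n)" using that K(1) by (intro powr_mono) auto
    also have "\<dots> = real n" using n by simp
    finally have "8 ^ k \<le> n" by (simp only: of_nat_le_iff)
    then show ?thesis by auto
  qed
  obtain t where t: "\<And>k. k \<in> {..K} \<Longrightarrow> least_queries (trunc_geom r {1..8 ^ k}) t \<le> q"
    "(\<Sum>k\<in>{..K}. 1) * (13 / 20) \<le> (\<Sum>k\<in>{..K}. 1 * of_bool (within_factor \<epsilon>
       (trunc_geom r {1..8 ^ k}) (least_output (trunc_geom r {1..8 ^ k}) t)) :: real)"
    by (rule good_tree_exists[OF A r, of "{..K}" "\<lambda>_. 1" "\<lambda>k. {1..8 ^ k}"]) (use sub in auto)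
  define C where "C = {k\<in>{..K}. within_factor \<epsilon> (trunc_geom r {1..8 ^ k})
    (least_output (trunc_geom r {1..8 ^ k}) t)}"
  have "(\<Sum>k\<in>{..K}. 1 * of_bool (within_factor \<epsilon>
       (trunc_geom r {1..8 ^ k}) (least_output (trunc_geom r {1..8 ^ k}) t)) :: real) = real (card C)"
    by (simp add: C_def of_bool_def sum.If_cases Int_def)
  with t(2) have "(real K + 1) * (13 / 20) \<le> real (card C)" by simp
  moreover have "card C + 1 \<le> 2 ^ (q + 1)"
    unfolding C_def by (rule card_correct_initial_segments[OF r(1,2) \<epsilon>]) (use t(1) in auto)
  then have "real (card C + 1) \<le> real (2 ^ (q + 1))" by (simp only: of_nat_le_iff)
  \<comment> \<open>At least 13/20 of the \<open>K + 1\<close> indices are correct, so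
    \<open>K + 1\<close> is at most 20/13 times \<open>2 ^ (q + 1)\<close>, and 20/13 < 2.\<close>
  ultimately have "log 8 (real n) \<le> 2 ^ (q + 2)" using K(2) by simp
  moreover have "log 8 (real n) = log 2 (real n) / 3"
  proof -
    have "log 2 (8::real) = 3" using log_pow_cancel[of 2 3] by simp
    then show ?thesis by (subst log_base_change[of 2]) auto
  qed
  ultimately have "log 2 (real n) \<le> 12 * 2 ^ q" by simp
  also have "\<dots> \<le> 2 ^ (q + 4)" by (simp add: power_add)
  finally have "log 2 (real n) \<le> 2 ^ (q + 4)" .
  moreover have "0 < log 2 (real n)" using n by simp
  ultimately have "log 2 (log 2 (real n)) \<le> log 2 (2 ^ (q + 4))" by (intro log_mono) auto
  then show ?thesis by (simp add: log_nat_power)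
qed

section \<open>Expectations over independent biased bits\<close>

text \<open>The expectation of \<open>F\<close> at a random subset of a finite \<open>U\<close> that
  contains each element independently with probability \<open>p\<close>. As a finite sum it splits
  at one bit by plain algebra.\<close>

definition bernoulli_avg :: "real \<Rightarrow> 'a set \<Rightarrow> ('a set \<Rightarrow> real) \<Rightarrow> real" where
  "bernoulli_avg p U F = (\<Sum>X\<in>Pow U. p ^ card X * (1 - p) ^ card (U - X) * F X)"

lemma bernoulli_avg_empty [simp]: "bernoulli_avg p {} F = F {}"
  by (simp add: bernoulli_avg_def)

lemma bernoulli_avg_insert:
  assumes "finite U" "i \<notin> U"
  shows "bernoulli_avg p (insert i U) F =
    (1 - p) * bernoulli_avg p U F + p * bernoulli_avg p U (\<lambda>X. F (insert i X))"
proof -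
  let ?w = "\<lambda>X. p ^ card X * (1 - p) ^ card (insert i U - X) * F X"
  have fin: "finite X" if "X \<in> Pow U" for X using that assms(1) finite_subset by blast
  have "bernoulli_avg p (insert i U) F = sum ?w (Pow U) + sum ?w (insert i ` Pow U)"
    unfolding bernoulli_avg_def Pow_insert
    by (rule sum.union_disjoint) (use assms in auto)
  also have "sum ?w (Pow U) = (1 - p) * bernoulli_avg p U F"
    unfolding bernoulli_avg_def sum_distrib_left
  proof (rule sum.cong)
    fix X assume X: "X \<in> Pow U"
    then have "insert i U - X = insert i (U - X)" using assms(2) by auto
    then have "card (insert i U - X) = Suc (card (U - X))" using assms by simp
    then show "?w X = (1 - p) * (p ^ card X * (1 - p) ^ card (U - X) * F X)" by simp
  qed simp
  also have "sum ?w (insert i ` Pow U) = sum (?w \<circ> insert i) (Pow U)"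
    by (rule sum.reindex) (use assms(2) in \<open>auto simp: inj_on_def\<close>)
  also have "\<dots> = p * bernoulli_avg p U (\<lambda>X. F (insert i X))"
    unfolding bernoulli_avg_def sum_distrib_left
  proof (rule sum.cong)
    fix X assume X: "X \<in> Pow U"
    then have "insert i U - insert i X = U - X" "i \<notin> X" using assms(2) by auto
    then show "(?w \<circ> insert i) X = p * (p ^ card X * (1 - p) ^ card (U - X) * F (insert i X))"
      using fin[OF X] by simp
  qed simp
  finally show ?thesis .
qed

lemma bernoulli_avg_remove:
  assumes "finite U" "i \<in> U"
  shows "bernoulli_avg p U F =
    (1 - p) * bernoulli_avg p (U - {i}) F + p * bernoulli_avg p (U - {i}) (\<lambda>X. F (insert i X))"
  using bernoulli_avg_insert[of "U - {i}" i p F] assms by (simp add: insert_absorb)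

lemma bernoulli_avg_const: "finite U \<Longrightarrow> bernoulli_avg p U (\<lambda>_. c) = c"
  by (induction U rule: finite_induct) (simp_all add: bernoulli_avg_insert algebra_simps)

lemma bernoulli_avg_mono:
  assumes "0 \<le> p" "p \<le> 1" "\<And>X. X \<subseteq> U \<Longrightarrow> F X \<le> G X"
  shows "bernoulli_avg p U F \<le> bernoulli_avg p U G"
  unfolding bernoulli_avg_def by (intro sum_mono mult_left_mono) (use assms in auto)

lemma bernoulli_avg_cong:
  "(\<And>X. X \<subseteq> U \<Longrightarrow> F X = G X) \<Longrightarrow> bernoulli_avg p U F = bernoulli_avg p U G"
  unfolding bernoulli_avg_def by (intro sum.cong) auto

lemma bernoulli_avg_nonneg:
  assumes "0 \<le> p" "p \<le> 1" "\<And>X. X \<subseteq> U \<Longrightarrow> 0 \<le> F X"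
  shows "0 \<le> bernoulli_avg p U F"
  unfolding bernoulli_avg_def by (intro sum_nonneg mult_nonneg_nonneg) (use assms in auto)

lemma bernoulli_avg_add:
  "bernoulli_avg p U (\<lambda>X. F X + G X) = bernoulli_avg p U F + bernoulli_avg p U G"
  by (simp add: bernoulli_avg_def distrib_left sum.distrib)

lemma bernoulli_avg_cmult:
  "bernoulli_avg p U (\<lambda>X. c * F X) = c * bernoulli_avg p U F"
  by (simp add: bernoulli_avg_def sum_distrib_left algebra_simps)

text \<open>The offset \<open>c\<close> serves the induction, since a new member of \<open>X\<close>
  raises it by one. For \<open>c = - p * card U\<close> the value is the variance.\<close>

lemma bernoulli_avg_card_sq:
  assumes "finite U"
  shows "bernoulli_avg p U (\<lambda>X. (real (card X) + c)\<^sup>2) =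
    (p * real (card U) + c)\<^sup>2 + p * (1 - p) * real (card U)"
  using assms
proof (induction U arbitrary: c rule: finite_induct)
  case (insert i U)
  have "bernoulli_avg p U (\<lambda>X. (real (card (insert i X)) + c)\<^sup>2) =
      bernoulli_avg p U (\<lambda>X. (real (card X) + (c + 1))\<^sup>2)"
  proof (rule bernoulli_avg_cong)
    fix X assume "X \<subseteq> U"
    then have "i \<notin> X" "finite X" using insert.hyps finite_subset by auto
    then show "(real (card (insert i X)) + c)\<^sup>2 = (real (card X) + (c + 1))\<^sup>2"
      by (simp add: algebra_simps)
  qed
  then have "bernoulli_avg p (insert i U) (\<lambda>X. (real (card X) + c)\<^sup>2) =
      (1 - p) * ((p * real (card U) + c)\<^sup>2 + p * (1 - p) * real (card U)) +
      p * ((p * real (card U) + (c + 1))\<^sup>2 + p * (1 - p) * real (card U))"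
    by (simp only: bernoulli_avg_insert[OF insert.hyps(1,2)] insert.IH)
  also have "\<dots> = (p * (real (card U) + 1) + c)\<^sup>2 + p * (1 - p) * (real (card U) + 1)"
    by (simp add: power2_eq_square algebra_simps)
  finally show ?case using insert.hyps by (simp add: add.commute)
qed simp

lemma bernoulli_avg_chebyshev:
  assumes "finite U" "0 \<le> p" "p \<le> 1" "0 < a"
  shows "bernoulli_avg p U (\<lambda>X. of_bool (a < \<bar>real (card X) - p * real (card U)\<bar>)) \<le>
    real (card U) / (4 * a\<^sup>2)"
proof -
  have "bernoulli_avg p U (\<lambda>X. of_bool (a < \<bar>real (card X) - p * real (card U)\<bar>)) \<le>
      bernoulli_avg p U (\<lambda>X. (1 / a\<^sup>2) * (real (card X) + - (p * real (card U)))\<^sup>2)"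
  proof (rule bernoulli_avg_mono)
    fix X
    show "of_bool (a < \<bar>real (card X) - p * real (card U)\<bar>) \<le>
      (1 / a\<^sup>2) * (real (card X) + - (p * real (card U)))\<^sup>2"
    proof (cases "a < \<bar>real (card X) - p * real (card U)\<bar>")
      case True
      then have "a\<^sup>2 \<le> (real (card X) - p * real (card U))\<^sup>2"
        using assms(4) by (simp add: power2_le_iff_abs_le abs_le_square_iff[symmetric])
      then show ?thesis using assms(4) by (simp add: True field_simps)
    qed simp
  qed (use assms in auto)
  also have "\<dots> = (1 / a\<^sup>2) * (p * (1 - p) * real (card U))"
    unfolding bernoulli_avg_cmult bernoulli_avg_card_sq[OF assms(1)] by simp
  also have "\<dots> \<le> (1 / a\<^sup>2) * (1 / 4 * real (card U))"
  proof (intro mult_left_mono mult_right_mono)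
    show "p * (1 - p) \<le> 1 / 4"
      using zero_le_power2[of "p - 1 / 2"] by (simp add: power2_eq_square algebra_simps)
  qed auto
  finally show ?thesis by (simp add: field_simps)
qed

text \<open>Cauchy--Schwarz in the form in which the chi-square bound passes through one revealed bit.\<close>

lemma weighted_square_le:
  fixes a b :: real
  assumes "a\<^sup>2 \<le> u * x" "b\<^sup>2 \<le> v * y" "0 \<le> u" "0 \<le> v" "0 \<le> x" "0 \<le> y"
    and "2 * (1 - p)\<^sup>2 * u + 2 * p\<^sup>2 * v \<le> w"
  shows "((1 - p) * a + p * b)\<^sup>2 \<le> w * (x / 2 + y / 2)"
proof -
  have ab: "(a * b)\<^sup>2 \<le> (u * y) * (v * x)"
    using mult_mono[OF assms(1,2)] assms(3-6) by (simp add: power_mult_distrib algebra_simps)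
  have "(2 * (1 - p) * p * (a * b))\<^sup>2 \<le> ((1 - p)\<^sup>2 * u * y + p\<^sup>2 * v * x)\<^sup>2"
  proof -
    have "(2 * (1 - p) * p * (a * b))\<^sup>2 = 4 * ((1 - p)\<^sup>2 * p\<^sup>2) * (a * b)\<^sup>2"
      by (simp add: power2_eq_square algebra_simps)
    also have "\<dots> \<le> 4 * ((1 - p)\<^sup>2 * p\<^sup>2) * ((u * y) * (v * x))"
      by (intro mult_left_mono ab) auto
    also have "\<dots> = 4 * ((1 - p)\<^sup>2 * u * y) * (p\<^sup>2 * v * x)"
      by (simp add: algebra_simps)
    also have "\<dots> \<le> ((1 - p)\<^sup>2 * u * y + p\<^sup>2 * v * x)\<^sup>2"
      using zero_le_power2[of "(1 - p)\<^sup>2 * u * y - p\<^sup>2 * v * x"]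
      unfolding power2_diff power2_sum by linarith
    finally show ?thesis .
  qed
  then have cross: "2 * (1 - p) * p * (a * b) \<le> (1 - p)\<^sup>2 * u * y + p\<^sup>2 * v * x"
    by (rule power2_le_imp_le) (use assms in auto)
  have "((1 - p) * a + p * b)\<^sup>2 = (1 - p)\<^sup>2 * a\<^sup>2 + p\<^sup>2 * b\<^sup>2 + 2 * (1 - p) * p * (a * b)"
    by (simp add: power2_eq_square algebra_simps)
  also have "\<dots> \<le> (1 - p)\<^sup>2 * (u * x) + p\<^sup>2 * (v * y) + ((1 - p)\<^sup>2 * u * y + p\<^sup>2 * v * x)"
    by (intro add_mono mult_left_mono assms cross) auto
  also have "\<dots> = (2 * (1 - p)\<^sup>2 * u + 2 * p\<^sup>2 * v) * (x / 2 + y / 2)"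
    by (simp add: field_simps)
  also have "\<dots> \<le> w * (x / 2 + y / 2)"
    by (intro mult_right_mono assms) (use assms in auto)
  finally show ?thesis .
qed

section \<open>Chi-square bounds between bias \<open>p\<close> and bias 1/2\<close>

text \<open>For an event \<open>F\<close>, Cauchy-Schwarz gives this with \<open>w\<close> the
  second moment of the likelihood ratio, that is, 1 plus the chi-square divergence. Stating it for
  \<open>F\<close> directly avoids distributions of transcripts.\<close>

definition chi_bounded :: "real \<Rightarrow> real \<Rightarrow> 'a set \<Rightarrow> ('a set \<Rightarrow> real) \<Rightarrow> bool" where
  "chi_bounded p w U F \<longleftrightarrow> (bernoulli_avg p U F)\<^sup>2 \<le> w * bernoulli_avg (1 / 2) U F"

lemma chi_bounded_cong:
  "(\<And>X. X \<subseteq> U \<Longrightarrow> F X = G X) \<Longrightarrow> chi_bounded p w U F \<longleftrightarrow> chi_bounded p w U G"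
  unfolding chi_bounded_def using bernoulli_avg_cong[of U F G] by simp

lemma chi_bounded_mono:
  assumes "chi_bounded p v U F" "v \<le> w" "\<And>X. 0 \<le> F X"
  shows "chi_bounded p w U F"
  using assms bernoulli_avg_nonneg[of "1 / 2" U F]
    mult_right_mono[of v w "bernoulli_avg (1 / 2) U F"]
  unfolding chi_bounded_def by force

text \<open>Conditioning on bit \<open>i\<close>. The coefficients are the squared likelihood ratios
  \<open>(2 * (1 - p))^2\<close> and \<open>(2 * p)^2\<close> of the two outcomes, each weighted by
  1/2.\<close>

lemma chi_bounded_reveal:
  assumes "finite U" "i \<in> U" "\<And>X. 0 \<le> F X" "0 \<le> u" "0 \<le> v"
    and "chi_bounded p u (U - {i}) F" "chi_bounded p v (U - {i}) (\<lambda>X. F (insert i X))"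
    and "2 * (1 - p)\<^sup>2 * u + 2 * p\<^sup>2 * v \<le> w"
  shows "chi_bounded p w U F"
proof -
  have "0 \<le> bernoulli_avg (1 / 2) (U - {i}) F"
    "0 \<le> bernoulli_avg (1 / 2) (U - {i}) (\<lambda>X. F (insert i X))"
    using assms(3) by (auto intro!: bernoulli_avg_nonneg)
  from weighted_square_le[OF assms(6,7)[unfolded chi_bounded_def] assms(4,5) this assms(8)]
  show ?thesis by (simp add: chi_bounded_def bernoulli_avg_remove[OF assms(1,2)])
qed

section \<open>Supports that encode bits in pairs\<close>

text \<open>The odd elements, always present, shield the pairs from each other: the gap after an
  element of pair \<open>i\<close> depends on no bit other than the \<open>i\<close>-th, so neither
  does its weight.\<close>

definition pair_support :: "nat \<Rightarrow> nat set \<Rightarrow> nat set" where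
  "pair_support m x = (\<lambda>i. 2 * i + 1) ` {..<m} \<union> (\<lambda>i. 2 * i + 2) ` x"

lemma odd_in_pair_support [simp]: "Suc (2 * i) \<in> pair_support m x \<longleftrightarrow> i < m"
  unfolding pair_support_def by (auto simp: image_iff) presburger

lemma even_in_pair_support [simp]: "Suc (Suc (2 * i)) \<in> pair_support m x \<longleftrightarrow> i \<in> x"
  unfolding pair_support_def by (auto simp: image_iff) presburger

lemma pair_support_cases:
  assumes "e \<in> pair_support m x"
  obtains i where "e = Suc (2 * i)" "i < m" | i where "e = Suc (Suc (2 * i))" "i \<in> x"
  using assms unfolding pair_support_def by auto

lemma one_in_pair_support: "0 < m \<Longrightarrow> 1 \<in> pair_support m x"
  using odd_in_pair_support[of 0 m x] by simp

lemma pair_support_subset: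
  assumes "x \<subseteq> {..<m}"
  shows "pair_support m x \<subseteq> {1..2 * m}"
  using assms by (auto simp: pair_support_def)

lemma card_pair_support:
  assumes "finite x"
  shows "card (pair_support m x) = m + card x"
proof -
  have "card (pair_support m x) =
      card ((\<lambda>i. 2 * i + 1) ` {..<m}) + card ((\<lambda>i. 2 * i + 2) ` x)"
    unfolding pair_support_def
    by (rule card_Un_disjoint) (use assms in \<open>auto, presburger\<close>)
  also have "\<dots> = m + card x" by (simp add: card_image inj_on_def)
  finally show ?thesis .
qed

text \<open>The next element is the odd one of pair \<open>i + 1\<close>, if that pair exists, so no
  further bit is disclosed. The threshold form is the one that \<open>pmf_trunc_geom_cong\<close>
  expects.\<close>

lemma ex_pair_support_above_even:
  assumes "x \<subseteq> {..<m}"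
  shows "(\<exists>t\<in>pair_support m x. Suc (Suc (2 * i)) < t \<and> t \<le> g) \<longleftrightarrow>
    Suc (2 * Suc i) \<le> g \<and> Suc i < m" (is "?L \<longleftrightarrow> ?R")
proof
  assume ?L
  then obtain t where t: "t \<in> pair_support m x" "Suc (Suc (2 * i)) < t" "t \<le> g" by blast
  from t(1) show ?R
  proof (cases rule: pair_support_cases)
    case (2 j)
    then show ?thesis using t assms by force
  qed (use t in auto)
next
  assume ?R
  then show ?L
    using odd_in_pair_support[of "Suc i" m x] by (intro bexI[of _ "Suc (2 * Suc i)"]) auto
qed

lemma ex_pair_support_above_odd:
  assumes "x \<subseteq> {..<m}"
  shows "(\<exists>t\<in>pair_support m x. Suc (2 * i) < t \<and> t \<le> g) \<longleftrightarrow>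
    (if i \<in> x then Suc (Suc (2 * i)) \<le> g else Suc (2 * Suc i) \<le> g \<and> Suc i < m)"
proof -
  have "(\<exists>t\<in>pair_support m x. Suc (2 * i) < t \<and> t \<le> g) \<longleftrightarrow>
     (i \<in> x \<and> Suc (Suc (2 * i)) \<le> g) \<or>
     (\<exists>t\<in>pair_support m x. Suc (Suc (2 * i)) < t \<and> t \<le> g)" (is "?L \<longleftrightarrow> ?R")
  proof
    assume ?L
    then obtain t where t: "t \<in> pair_support m x" "Suc (2 * i) < t" "t \<le> g" by blast
    then show ?R by (cases "t = Suc (Suc (2 * i))") (auto intro!: bexI[of _ t])
  next
    assume ?R
    then show ?L
    proof (elim disjE)
      assume "i \<in> x \<and> Suc (Suc (2 * i)) \<le> g"
      then show ?thesis by (intro bexI[of _ "Suc (Suc (2 * i))"]) auto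
    qed (use Suc_lessD in blast)
  qed
  then show ?thesis unfolding ex_pair_support_above_even[OF assms] by auto
qed

lemma pmf_pair_support_odd:
  assumes "i < m" "x \<subseteq> {..<m}" "y \<subseteq> {..<m}" "i \<in> x \<longleftrightarrow> i \<in> y"
  shows "pmf (trunc_geom r (pair_support m x)) (Suc (2 * i)) =
    pmf (trunc_geom r (pair_support m y)) (Suc (2 * i))"
proof (rule pmf_trunc_geom_cong)
  show "(\<exists>t\<in>pair_support m x. Suc (2 * i) < t \<and> t \<le> g) \<longleftrightarrow>
    (\<exists>t\<in>pair_support m y. Suc (2 * i) < t \<and> t \<le> g)" for g
    using assms(4) by (simp only: ex_pair_support_above_odd[OF assms(2)] ex_pair_support_above_odd[OF assms(3)])
qed (use assms(1) one_in_pair_support in auto)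

lemma pmf_pair_support_even:
  assumes "x \<subseteq> {..<m}" "y \<subseteq> {..<m}" "i \<in> x" "i \<in> y"
  shows "pmf (trunc_geom r (pair_support m x)) (Suc (Suc (2 * i))) =
    pmf (trunc_geom r (pair_support m y)) (Suc (Suc (2 * i)))"
proof (rule pmf_trunc_geom_cong)
  show "(\<exists>t\<in>pair_support m x. Suc (Suc (2 * i)) < t \<and> t \<le> g) \<longleftrightarrow>
    (\<exists>t\<in>pair_support m y. Suc (Suc (2 * i)) < t \<and> t \<le> g)" for g
    by (simp only: ex_pair_support_above_even[OF assms(1)] ex_pair_support_above_even[OF assms(2)])
  have "0 < m" using assms by auto
  then show "1 \<in> pair_support m x" "1 \<in> pair_support m y" by (simp_all only: one_in_pair_support)
qed (use assms in auto)

text \<open>The first inequality is for a bit whose value 0 lets the scan continue and whose value 1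
  stops it, the second for a bit that is read while stopping. The first dictates the constant 8; the
  second would hold with 4.\<close>

lemma chi_square_factor:
  fixes d :: real
  assumes "0 \<le> d" "d \<le> 1 / 2" "0 \<le> v"
  shows "2 * (1 - (1 / 2 + d))\<^sup>2 * ((1 + 8 * d\<^sup>2) * v) + 2 * (1 / 2 + d)\<^sup>2 * v \<le> (1 + 8 * d\<^sup>2) * v"
    and "2 * (1 - (1 / 2 + d))\<^sup>2 * v + 2 * (1 / 2 + d)\<^sup>2 * v \<le> (1 + 8 * d\<^sup>2) * v"
proof -
  have "(1 + 8 * d\<^sup>2) - (2 * (1 - (1 / 2 + d))\<^sup>2 * (1 + 8 * d\<^sup>2) + 2 * (1 / 2 + d)\<^sup>2) =
      16 * d ^ 3 * (1 - d)"
    by (simp add: power2_eq_square power3_eq_cube field_simps)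
  moreover have "0 \<le> 16 * d ^ 3 * (1 - d)" using assms by simp
  ultimately have "2 * (1 - (1 / 2 + d))\<^sup>2 * (1 + 8 * d\<^sup>2) + 2 * (1 / 2 + d)\<^sup>2 \<le> 1 + 8 * d\<^sup>2"
    by linarith
  from mult_right_mono[OF this assms(3)]
  show "2 * (1 - (1 / 2 + d))\<^sup>2 * ((1 + 8 * d\<^sup>2) * v) + 2 * (1 / 2 + d)\<^sup>2 * v \<le> (1 + 8 * d\<^sup>2) * v"
    by (simp add: distrib_right mult.assoc)
  have "2 * (1 - (1 / 2 + d))\<^sup>2 + 2 * (1 / 2 + d)\<^sup>2 = 1 + 4 * d\<^sup>2"
    by (simp add: power2_eq_square field_simps)
  then have "2 * (1 - (1 / 2 + d))\<^sup>2 + 2 * (1 / 2 + d)\<^sup>2 \<le> 1 + 8 * d\<^sup>2"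
    using zero_le_power2[of d] by linarith
  from mult_right_mono[OF this assms(3)]
  show "2 * (1 - (1 / 2 + d))\<^sup>2 * v + 2 * (1 / 2 + d)\<^sup>2 * v \<le> (1 + 8 * d\<^sup>2) * v"
    by (simp add: distrib_right mult.assoc)
qed

text \<open>A query reads the unknown bits in order and stops at the first pair that meets it in the
  support.  Continuing costs nothing and stopping costs one factor \<open>1 + 8 d\<^sup>2\<close>, so the number of
  bits that a query reads does not matter.  The set \<open>V\<close> contains the known ones, \<open>U\<close> the unknown
  bits.\<close>

lemma chi_bounded_least_output:
  fixes d :: real
  assumes r: "0 < r" "r < 1" and m: "0 < m" and d: "0 \<le> d" "d \<le> 1 / 2"
    and "U \<subseteq> {..<m}" "V \<subseteq> {..<m}" "U \<inter> V = {}"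
    and "\<And>X. X \<subseteq> U \<Longrightarrow> least_queries (trunc_geom r (pair_support m (V \<union> X))) t \<le> q"
  shows "chi_bounded (1 / 2 + d) ((1 + 8 * d\<^sup>2) ^ q) U
    (\<lambda>X. of_bool (P (least_output (trunc_geom r (pair_support m (V \<union> X))) t)))"
  using assms(6-)
proof (induction t arbitrary: U V q)
  case (Output s)
  have "finite U" using Output(1) finite_subset by blast
  then show ?case by (simp add: chi_bounded_def bernoulli_avg_const)
next
  case (Query S f)
  define D where "D x = trunc_geom r (pair_support m x)" for x
  define \<beta> where "\<beta> = 1 + 8 * d\<^sup>2"
  have \<beta>: "1 \<le> \<beta>" by (simp add: \<beta>_def)
  have set: "set_pmf (D x) = pair_support m x" for x
    unfolding D_def
    by (rule set_trunc_geom[OF r one_in_pair_support[OF m]]) (auto elim: pair_support_cases)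
  obtain q' where q': "q = Suc q'" using Query.prems(4)[of "{}"] by (cases q) auto
  define G where "G W X = (of_bool (P (least_output (D (W \<union> X)) (Query S f))) :: real)" for W X
  have G_nonneg: "0 \<le> G W X" for W X by (simp add: G_def)
  \<comment> \<open>States of the scan: revealed ones have moved from \<open>U\<close> to
    \<open>W\<close>, revealed zeros are in neither \<open>U'\<close> nor \<open>W\<close>.\<close>
  define sub where "sub U' W \<longleftrightarrow> U' \<subseteq> U \<and> V \<subseteq> W \<and> W \<subseteq> V \<union> U \<and> U' \<inter> W = {}" for U' W
  have sub_fin: "finite U'" "W \<union> X \<subseteq> {..<m}" if "sub U' W" "X \<subseteq> U'" for U' W X
    using that Query.prems(1,2) finite_subset[of U' "{..<m}"] by (auto simp: sub_def)
  have const: "chi_bounded (1 / 2 + d) (\<beta> ^ q') U' (G W)"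
    if s: "sub U' W" and a: "\<And>X. X \<subseteq> U' \<Longrightarrow> least_answer (D (W \<union> X)) S = a" for U' W a
  proof -
    have "chi_bounded (1 / 2 + d) (\<beta> ^ q') U' (\<lambda>X. of_bool (P (least_output (D (W \<union> X)) (f a))))"
      unfolding D_def \<beta>_def
    proof (rule Query.IH[OF rangeI])
      show "U' \<subseteq> {..<m}" "W \<subseteq> {..<m}" "U' \<inter> W = {}"
        using s Query.prems(1,2) by (auto simp: sub_def)
      fix X assume X: "X \<subseteq> U'"
      have "V \<union> ((W - V) \<union> X) = W \<union> X" "(W - V) \<union> X \<subseteq> U" using s X by (auto simp: sub_def)
      then have "least_queries (D (W \<union> X)) (Query S f) \<le> q"
        using Query.prems(4)[of "(W - V) \<union> X"] by (simp add: D_def)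
      then show "least_queries (trunc_geom r (pair_support m (W \<union> X))) (f a) \<le> q'"
        using a[OF X] by (simp add: D_def q')
    qed
    then show ?thesis
      by (subst chi_bounded_cong[of _ _ "\<lambda>X. of_bool (P (least_output (D (W \<union> X)) (f a)))"])
        (use a in \<open>auto simp: G_def\<close>)
  qed
  have const': "chi_bounded (1 / 2 + d) (\<beta> ^ q) U' (G W)"
    if "sub U' W" "\<And>X. X \<subseteq> U' \<Longrightarrow> least_answer (D (W \<union> X)) S = a" for U' W a
    by (rule chi_bounded_mono[OF const[OF that]]) (use \<beta> q' G_nonneg in auto)
  have odd: "least_answer (D x) S = Some (Suc (2 * i), pmf (D y) (Suc (2 * i)))"
    if "Suc (2 * i) \<in> S" "i < m" "x \<subseteq> {..<m}" "y \<subseteq> {..<m}" "i \<in> x \<longleftrightarrow> i \<in> y"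
      "\<And>e. e \<in> S \<Longrightarrow> e \<in> pair_support m x \<Longrightarrow> 2 * i < e" for i x y
  proof -
    have "least_answer (D x) S = Some (Suc (2 * i), pmf (D x) (Suc (2 * i)))"
      by (rule least_answer_eq_Some) (use that set in \<open>auto simp: Suc_le_eq\<close>)
    moreover have "pmf (D x) (Suc (2 * i)) = pmf (D y) (Suc (2 * i))"
      unfolding D_def by (rule pmf_pair_support_odd) (use that in auto)
    ultimately show ?thesis by simp
  qed
  have even: "least_answer (D x) S = Some (Suc (Suc (2 * i)), pmf (D {i}) (Suc (Suc (2 * i))))"
    if "Suc (2 * i) \<notin> S" "Suc (Suc (2 * i)) \<in> S" "x \<subseteq> {..<m}" "i \<in> x"
      "\<And>e. e \<in> S \<Longrightarrow> e \<in> pair_support m x \<Longrightarrow> 2 * i < e" for i x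
  proof -
    have "least_answer (D x) S = Some (Suc (Suc (2 * i)), pmf (D x) (Suc (Suc (2 * i))))"
    proof (rule least_answer_eq_Some)
      fix e assume e: "e \<in> S" "e \<in> set_pmf (D x)"
      then have "2 * i < e" "e \<noteq> Suc (2 * i)" using that set by auto
      then show "Suc (Suc (2 * i)) \<le> e" by linarith
    qed (use that set in auto)
    moreover have "pmf (D x) (Suc (Suc (2 * i))) = pmf (D {i}) (Suc (Suc (2 * i)))"
      unfolding D_def by (rule pmf_pair_support_even) (use that in auto)
    ultimately show ?thesis by simp
  qed
  \<comment> \<open>After a 1 the scan stops. After a 0 it either goes on, still owing the factor
    \<beta> (\<open>u = \<beta> ^ q\<close>), or stops as well
    (\<open>u = \<beta> ^ q'\<close>).\<close>
  have reveal: "chi_bounded (1 / 2 + d) (\<beta> ^ q) U' (G W)"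
    if "sub U' W" "i \<in> U'" and u: "u = \<beta> ^ q \<or> u = \<beta> ^ q'"
      and "chi_bounded (1 / 2 + d) u (U' - {i}) (G W)"
      and "chi_bounded (1 / 2 + d) (\<beta> ^ q') (U' - {i}) (G (insert i W))" for U' W i u
  proof (rule chi_bounded_reveal)
    show "finite U'" using sub_fin(1)[OF that(1), of "{}"] by simp
    show "0 \<le> u" "0 \<le> \<beta> ^ q'" using u \<beta> by auto
    show "chi_bounded (1 / 2 + d) (\<beta> ^ q') (U' - {i}) (\<lambda>X. G W (insert i X))"
      using that(5) by (simp add: G_def[abs_def])
    show "2 * (1 - (1 / 2 + d))\<^sup>2 * u + 2 * (1 / 2 + d)\<^sup>2 * \<beta> ^ q' \<le> \<beta> ^ q"
      using u chi_square_factor[OF d, of "\<beta> ^ q'"] \<beta> unfolding q' power_Suc \<beta>_def by auto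
  qed (use that G_nonneg in auto)
  \<comment> \<open>Downward induction on the pair \<open>i\<close> that the scan has reached: no
    possible support meets \<open>S\<close> in an earlier pair, that is, at or below
    \<open>2 * i\<close>.\<close>
  have step: "\<forall>U' W. sub U' W \<longrightarrow>
      (\<forall>X\<subseteq>U'. \<forall>e\<in>S. e \<in> pair_support m (W \<union> X) \<longrightarrow> 2 * i < e) \<longrightarrow>
      chi_bounded (1 / 2 + d) (\<beta> ^ q) U' (G W)" if "i \<le> m" for i
    using that
  proof (induction i rule: inc_induct)
    case base
    show ?case
    proof (intro allI impI)
      fix U' W assume s: "sub U' W"
        and e: "\<forall>X\<subseteq>U'. \<forall>e\<in>S. e \<in> pair_support m (W \<union> X) \<longrightarrow> 2 * m < e"
      show "chi_bounded (1 / 2 + d) (\<beta> ^ q) U' (G W)"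
      proof (rule const'[OF s])
        fix X assume X: "X \<subseteq> U'"
        have "2 * m < e" "e \<le> 2 * m" if "e \<in> S" "e \<in> pair_support m (W \<union> X)" for e
          using e X that subsetD[OF pair_support_subset[OF sub_fin(2)[OF s X]] that(2)] by auto
        then have "S \<inter> pair_support m (W \<union> X) = {}" by (meson disjoint_iff not_le)
        then show "least_answer (D (W \<union> X)) S = None"
          by (intro least_answer_eq_None) (simp add: set)
      qed
    qed
  next
    case (step i)
    show ?case
    proof (intro allI impI)
      fix U' W assume s: "sub U' W"
        and e: "\<forall>X\<subseteq>U'. \<forall>e\<in>S. e \<in> pair_support m (W \<union> X) \<longrightarrow> 2 * i < e"
      have e0: "2 * i < e" if "X \<subseteq> U'" "e \<in> S" "e \<in> pair_support m (W \<union> X)" for X e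
        using e that by blast
      have s0: "sub (U' - {i}) W" using s by (auto simp: sub_def)
      have s1: "sub (U' - {i}) (insert i W)" if "i \<in> U'" using s that by (auto simp: sub_def)
      have e1: "2 * i < e" if "i \<in> U'" "X \<subseteq> U' - {i}" "e \<in> S"
        "e \<in> pair_support m (insert i W \<union> X)" for X e
      proof -
        have "insert i X \<subseteq> U'" using that by auto
        moreover have "insert i W \<union> X = W \<union> insert i X" by auto
        ultimately show ?thesis using e0[of "insert i X" e] that(3,4) by simp
      qed
      have next_pair: "chi_bounded (1 / 2 + d) (\<beta> ^ q) U'' (G W)"
        if "U'' \<subseteq> U'" "Suc (2 * i) \<notin> S" "Suc (Suc (2 * i)) \<in> S \<longrightarrow> i \<notin> W \<union> U''" for U''
      proof (rule step.IH[rule_format])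
        show "sub U'' W" using s that by (auto simp: sub_def)
        fix X e assume "X \<subseteq> U''" "e \<in> S" "e \<in> pair_support m (W \<union> X)"
        moreover from this have "2 * i < e" using e0[of X e] that(1) by blast
        moreover have "e \<noteq> Suc (2 * i)" "e \<noteq> Suc (Suc (2 * i))" using calculation that by auto
        ultimately show "2 * Suc i < e" by simp
      qed
      show "chi_bounded (1 / 2 + d) (\<beta> ^ q) U' (G W)"
      proof (cases "Suc (2 * i) \<in> S")
        \<comment> \<open>The odd element is in every support, so the scan stops here, and its
          weight discloses bit \<open>i\<close>.\<close>
        case odd_in: True
        show ?thesis
        proof (cases "i \<in> U'")
          case True
          have "chi_bounded (1 / 2 + d) (\<beta> ^ q') (U' - {i}) (G W)"
          proof (rule const[OF s0])
            fix X assume X: "X \<subseteq> U' - {i}"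
            then have X': "X \<subseteq> U'" by blast
            show "least_answer (D (W \<union> X)) S = Some (Suc (2 * i), pmf (D {}) (Suc (2 * i)))"
              by (rule odd) (use odd_in step.hyps X e0[OF X'] s True sub_fin(2)[OF s0 X] in \<open>auto simp: sub_def\<close>)
          qed
          moreover have "chi_bounded (1 / 2 + d) (\<beta> ^ q') (U' - {i}) (G (insert i W))"
          proof (rule const[OF s1[OF True]])
            fix X assume X: "X \<subseteq> U' - {i}"
            show "least_answer (D (insert i W \<union> X)) S = Some (Suc (2 * i), pmf (D {i}) (Suc (2 * i)))"
              by (rule odd) (use odd_in step.hyps e1[OF True X] sub_fin(2)[OF s1[OF True] X] in auto)
          qed
          ultimately show ?thesis using reveal[OF s True] by blast
        next
          case False
          show ?thesis
          proof (rule const'[OF s])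
            fix X assume X: "X \<subseteq> U'"
            show "least_answer (D (W \<union> X)) S =
                Some (Suc (2 * i), pmf (D (W \<inter> {i})) (Suc (2 * i)))"
              by (rule odd) (use odd_in step.hyps X e0[OF X] False sub_fin(2)[OF s X] in auto)
          qed
        qed
      next
        case odd_notin: False
        show ?thesis
        proof (cases "Suc (Suc (2 * i)) \<in> S \<and> i \<in> W \<union> U'")
          case even_in: True
          show ?thesis
          proof (cases "i \<in> U'")
            case True
            \<comment> \<open>With bit 0 the even element is absent and the scan passes on to the
              next pair.\<close>
            have "chi_bounded (1 / 2 + d) (\<beta> ^ q) (U' - {i}) (G W)"
              by (rule next_pair) (use odd_notin s True in \<open>auto simp: sub_def\<close>)
            moreover have "chi_bounded (1 / 2 + d) (\<beta> ^ q') (U' - {i}) (G (insert i W))"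
            proof (rule const[OF s1[OF True]])
              fix X assume X: "X \<subseteq> U' - {i}"
              show "least_answer (D (insert i W \<union> X)) S =
                  Some (Suc (Suc (2 * i)), pmf (D {i}) (Suc (Suc (2 * i))))"
                by (rule even) (use odd_notin even_in e1[OF True X] sub_fin(2)[OF s1[OF True] X] in auto)
            qed
            ultimately show ?thesis using reveal[OF s True] by blast
          next
            case False
            show ?thesis
            proof (rule const'[OF s])
              fix X assume X: "X \<subseteq> U'"
              show "least_answer (D (W \<union> X)) S =
                  Some (Suc (Suc (2 * i)), pmf (D {i}) (Suc (Suc (2 * i))))"
                by (rule even) (use odd_notin even_in False X e0[OF X] sub_fin(2)[OF s X] in auto)
            qed
          qed
        next
          case False
          show ?thesis by (rule next_pair) (use odd_notin False in auto)
        qed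
      qed
    qed
  qed
  have "chi_bounded (1 / 2 + d) (\<beta> ^ q) U (G V)"
  proof (rule step[of 0, rule_format])
    show "sub U V" using Query.prems(3) by (simp add: sub_def)
    show "2 * 0 < e" if "e \<in> pair_support m (V \<union> X)" for X e
      using that by (cases rule: pair_support_cases) auto
  qed simp
  then show ?case by (simp add: G_def[abs_def] D_def \<beta>_def)
qed

section \<open>The \<epsilon> term: distinguishing two biases\<close>

lemma eps_query_lower_bound:
  fixes \<epsilon> :: real
  assumes \<epsilon>: "0 < \<epsilon>" "\<epsilon> \<le> 1 / 100" and n: "1 / \<epsilon>\<^sup>2 \<le> real n"
    and A: "randomized_alg n A" "estimates_support n \<epsilon> A" "queries_at_most n q A"
  shows "1 / \<epsilon>\<^sup>2 \<le> 46080 * real q"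
proof -
  define r where "r = 1 / (100 * (real q + 1))"
  have r: "0 < r" "r < 1" "r * real q \<le> 1 / 100" by (auto simp: r_def field_simps)
  define m where "m = n div 2"
  \<comment> \<open>24 = 10 + 10 + 3 + 1: a deviation of \<open>10 * \<epsilon> * m\<close> for each
    bias, \<open>3 * \<epsilon>\<close> for two factors \<open>1 + \<epsilon>\<close> applied to
    3/2, and \<epsilon> for the terms of higher order.\<close>
  define d where "d = 24 * \<epsilon>"
  define p where "p = 1 / 2 + d"
  have d: "0 \<le> d" "d \<le> 1 / 2" using \<epsilon> by (auto simp: d_def)
  have p: "0 \<le> p" "p \<le> 1" using d by (auto simp: p_def)
  have \<epsilon>n: "1 \<le> \<epsilon>\<^sup>2 * real n" using n \<epsilon> by (simp add: field_simps)
  have \<epsilon>2: "\<epsilon>\<^sup>2 \<le> 1 / 10000"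
    using power_mono[OF \<epsilon>(2), of 2] \<epsilon>(1) by (simp add: power_divide)
  have \<epsilon>m: "49 / 100 \<le> \<epsilon>\<^sup>2 * real m"
  proof -
    have "real n \<le> 2 * real m + 1" unfolding m_def by linarith
    then have "\<epsilon>\<^sup>2 * real n \<le> \<epsilon>\<^sup>2 * (2 * real m + 1)" by (intro mult_left_mono) auto
    then show ?thesis using \<epsilon>n \<epsilon>2 by (simp add: algebra_simps)
  qed
  then have m: "0 < m" by (cases "m = 0") auto
  define D where "D x = trunc_geom r (pair_support m x)" for x
  define W :: "real \<Rightarrow> nat set \<Rightarrow> real" where "W p x = p ^ card x * (1 - p) ^ card ({..<m} - x)" for p x
  have avg: "bernoulli_avg p {..<m} F = (\<Sum>x\<in>Pow {..<m}. W p x * F x)" for p F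
    by (simp add: bernoulli_avg_def W_def)
  have sub: "pair_support m x \<subseteq> {1..n}" if "x \<in> Pow {..<m}" for x
    using pair_support_subset[of x m] that unfolding m_def by fastforce
  \<comment> \<open>The prior is the sum of both laws of the bits, so a single tree serves both
    biases, with total success at least 2 * 13/20.\<close>
  obtain t where t: "\<And>x. x \<in> Pow {..<m} \<Longrightarrow> least_queries (D x) t \<le> q"
    "(\<Sum>x\<in>Pow {..<m}. W (1 / 2) x + W p x) * (13 / 20) \<le> (\<Sum>x\<in>Pow {..<m}. (W (1 / 2) x + W p x) *
      of_bool (within_factor \<epsilon> (D x) (least_output (D x) t)))"
    unfolding D_def
  proof (rule good_tree_exists[OF A r, of "Pow {..<m}" "\<lambda>x. W (1 / 2) x + W p x" "pair_support m"])
    show "0 \<le> W (1 / 2) x + W p x" for x using p by (simp add: W_def)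
  qed (use sub one_in_pair_support[OF m] in auto)
  define s where "s x = (of_bool (within_factor \<epsilon> (D x) (least_output (D x) t)) :: real)" for x
  \<comment> \<open>The largest estimate that is still correct at bias 1/2 without a far deviation.
    The event \<open>B\<close>, exceeding it, is the test between the biases.\<close>
  define \<theta> where "\<theta> = (1 + \<epsilon>) * ((3 / 2 + 10 * \<epsilon>) * real m)"
  define B where "B x = (of_bool (\<theta> < least_output (D x) t) :: real)" for x
  define a where "a = 10 * \<epsilon> * real m"
  have a: "0 < a" using \<epsilon> m by (simp add: a_def)
  define far :: "real \<Rightarrow> nat set \<Rightarrow> real" where "far p x = (of_bool (a < \<bar>real (card x) - p * real (card {..<m})\<bar>) :: real)" for p x
  have "(\<Sum>x\<in>Pow {..<m}. W (1 / 2) x + W p x) = 2"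
    using avg[of "1 / 2" "\<lambda>_. 1"] avg[of p "\<lambda>_. 1"]
    by (simp add: bernoulli_avg_const sum.distrib)
  with t(2) have good: "13 / 10 \<le> bernoulli_avg (1 / 2) {..<m} s + bernoulli_avg p {..<m} s"
    by (simp add: avg s_def distrib_right sum.distrib)
  have far: "bernoulli_avg p {..<m} (far p) \<le> 1 / 190" if "0 \<le> p" "p \<le> 1" for p
  proof -
    have "bernoulli_avg p {..<m} (far p) \<le> real m / (4 * a\<^sup>2)"
      using bernoulli_avg_chebyshev[of "{..<m}" p a] that a by (simp add: far_def[abs_def])
    also have "\<dots> = 1 / (400 * (\<epsilon>\<^sup>2 * real m))"
      using m \<epsilon> by (simp add: a_def power2_eq_square field_simps)
    also have "\<dots> \<le> 1 / 190"
    proof (rule divide_left_mono)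
      show "190 \<le> 400 * (\<epsilon>\<^sup>2 * real m)" using \<epsilon>m by linarith
    qed (use \<epsilon> m in auto)
    finally show ?thesis .
  qed
  have card: "real (card (set_pmf (D x))) = real m + real (card x)" if "x \<subseteq> {..<m}" for x
  proof -
    have "set_pmf (D x) = pair_support m x" unfolding D_def
      by (rule set_trunc_geom[OF r(1,2) one_in_pair_support[OF m]]) (auto elim: pair_support_cases)
    then show ?thesis using card_pair_support[of x m] finite_subset[OF that] by simp
  qed
  have "bernoulli_avg (1 / 2) {..<m} (\<lambda>x. s x + B x) \<le> bernoulli_avg (1 / 2) {..<m} (\<lambda>x. 1 + far (1 / 2) x)"
  proof (rule bernoulli_avg_mono)
    fix x assume x: "x \<subseteq> {..<m}"
    have "\<not> \<theta> < least_output (D x) t"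
      if "within_factor \<epsilon> (D x) (least_output (D x) t)" "\<bar>real (card x) - real m / 2\<bar> \<le> a"
    proof -
      have "real m + real (card x) \<le> (3 / 2 + 10 * \<epsilon>) * real m"
        using that(2) by (simp add: a_def algebra_simps)
      then have "(1 + \<epsilon>) * (real m + real (card x)) \<le> \<theta>"
        unfolding \<theta>_def using \<epsilon> by (intro mult_left_mono) auto
      then show ?thesis using that(1) by (simp add: within_factor_def card[OF x])
    qed
    then show "s x + B x \<le> 1 + far (1 / 2) x" by (auto simp: s_def B_def far_def not_less)
  qed auto
  then have s1: "bernoulli_avg (1 / 2) {..<m} s + bernoulli_avg (1 / 2) {..<m} B \<le> 1 + 1 / 190"
    using far[of "1 / 2"] by (simp add: bernoulli_avg_add bernoulli_avg_const)
  have gap: "(1 + \<epsilon>) * \<theta> < (3 / 2 + d - 10 * \<epsilon>) * real m"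
  proof -
    have "(1 + \<epsilon>) * ((1 + \<epsilon>) * (3 / 2 + 10 * \<epsilon>)) =
        3 / 2 + 13 * \<epsilon> + \<epsilon> * (43 / 2 * \<epsilon> + 10 * \<epsilon>\<^sup>2)"
      by (simp add: power2_eq_square field_simps)
    also have "\<dots> < 3 / 2 + 13 * \<epsilon> + \<epsilon> * 1"
      using \<epsilon> \<epsilon>2 by (intro add_strict_left_mono mult_strict_left_mono) auto
    also have "\<dots> = 3 / 2 + d - 10 * \<epsilon>" by (simp add: d_def)
    finally have "(1 + \<epsilon>) * ((1 + \<epsilon>) * (3 / 2 + 10 * \<epsilon>)) * real m < (3 / 2 + d - 10 * \<epsilon>) * real m"
      using m by (intro mult_strict_right_mono) auto
    then show ?thesis by (simp only: \<theta>_def mult.assoc)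
  qed
  have "bernoulli_avg p {..<m} s \<le> bernoulli_avg p {..<m} (\<lambda>x. B x + far p x)"
  proof (rule bernoulli_avg_mono)
    fix x assume x: "x \<subseteq> {..<m}"
    have "\<theta> < least_output (D x) t"
      if "within_factor \<epsilon> (D x) (least_output (D x) t)" "\<bar>real (card x) - p * real m\<bar> \<le> a"
    proof -
      have "(3 / 2 + d - 10 * \<epsilon>) * real m \<le> real m + real (card x)"
        using that(2) by (simp add: a_def p_def algebra_simps)
      then have "(1 + \<epsilon>) * \<theta> < real m + real (card x)" using gap by linarith
      also have "\<dots> \<le> (1 + \<epsilon>) * least_output (D x) t"
        using that(1) \<epsilon> by (simp add: within_factor_def card[OF x] field_simps)
      finally show ?thesis using \<epsilon> by simp
    qed
    then show "s x \<le> B x + far p x" by (auto simp: s_def B_def far_def not_less)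
  qed (use p in auto)
  then have s2: "bernoulli_avg p {..<m} s \<le> bernoulli_avg p {..<m} B + 1 / 190"
    using far[OF p] by (simp add: bernoulli_avg_add)
  define w where "w = (1 + 8 * d\<^sup>2) ^ q"
  have w: "0 < w" unfolding w_def by (intro zero_less_power) (simp add: add_pos_nonneg)
  have "chi_bounded p w {..<m} B"
    using chi_bounded_least_output[OF r(1,2) m d, of "{..<m}" "{}" t q "\<lambda>v. \<theta> < v"] t(1)
    by (simp add: p_def w_def B_def[abs_def] D_def)
  then have "(bernoulli_avg p {..<m} B)\<^sup>2 \<le> w * bernoulli_avg (1 / 2) {..<m} B"
    by (simp add: chi_bounded_def)
  \<comment> \<open>The square is replaced by its tangent at \<open>w / 2\<close>, which turns the
    chi-square bound into a bound by \<open>w / 4\<close> on the gap between the probabilities of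
    \<open>B\<close>. Success at both biases needs a gap of at least 3/10 - 2/190.\<close>
  moreover have "w * bernoulli_avg p {..<m} B - w * (w / 4) \<le> (bernoulli_avg p {..<m} B)\<^sup>2"
    using zero_le_power2[of "bernoulli_avg p {..<m} B - w / 2"]
    by (simp add: power2_eq_square algebra_simps)
  ultimately have "w * (bernoulli_avg p {..<m} B - w / 4) \<le> w * bernoulli_avg (1 / 2) {..<m} B"
    by (simp add: algebra_simps)
  then have "bernoulli_avg p {..<m} B - w / 4 \<le> bernoulli_avg (1 / 2) {..<m} B"
    using w by simp
  with s1 s2 good have w_ge: "115 / 100 \<le> w" by simp
  show ?thesis
  proof (rule ccontr)
    assume "\<not> ?thesis"
    then have "46080 * real q * \<epsilon>\<^sup>2 < 1" using \<epsilon> by (simp add: field_simps)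
    \<comment> \<open>8 * 24^2 = 4608, a tenth of 46080. Then \<open>w\<close> is at most
      \<open>exp (1 / 10)\<close>, below 115/100.\<close>
    then have z: "real q * (8 * d\<^sup>2) \<le> 1 / 10" by (simp add: d_def power_mult_distrib)
    have "w \<le> exp (8 * d\<^sup>2) ^ q"
      unfolding w_def by (intro power_mono exp_ge_add_one_self) (simp add: add_nonneg_nonneg)
    also have "\<dots> = exp (real q * (8 * d\<^sup>2))" by (simp add: exp_of_nat_mult)
    also have "\<dots> \<le> exp (1 / 10)" using z by simp
    also have "\<dots> \<le> 1 + 1 / 10 + (1 / 10)\<^sup>2" by (rule exp_bound) auto
    finally show False using w_ge by (simp add: power2_eq_square)
  qed
qed

section \<open>Combining the two terms\<close>

theorem theorem1p1:
  shows "\<exists>c>0. \<exists>n0. \<forall>n\<ge>n0. \<forall>\<epsilon>::real. \<forall>A q.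
    0 < \<epsilon> \<longrightarrow> \<epsilon> \<le> 1 \<longrightarrow> 1 / \<epsilon>\<^sup>2 \<le> real n \<longrightarrow>
    randomized_alg n A \<longrightarrow> estimates_support n \<epsilon> A \<longrightarrow> queries_at_most n q A \<longrightarrow>
    real q \<ge> c * query_bound n \<epsilon>"
\<comment> \<open>For these \<open>n\<close> the double logarithm is at least 8, so the additive 4
  in the first bound is absorbed into \<open>2 * q\<close>. The factor 1/100000 covers 2 +
  46080.\<close>
proof (intro exI[of _ "1 / 100000 :: real"] exI[of _ "2 ^ 2 ^ 8 :: nat"] conjI allI impI)
  fix n :: nat and \<epsilon> :: real and A q
  assume n: "2 ^ 2 ^ 8 \<le> n" and \<epsilon>: "0 < \<epsilon>" "\<epsilon> \<le> 1" and \<epsilon>n: "1 / \<epsilon>\<^sup>2 \<le> real n"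
    and A: "randomized_alg n A" "estimates_support n \<epsilon> A" "queries_at_most n q A"
  have "(2::nat) ^ 1 \<le> 2 ^ 2 ^ 8" by (rule power_increasing) auto
  then have "2 \<le> n" using n by simp
  define L where "L = log 2 (log 2 (real n))"
  have "(2::real) ^ 2 ^ 8 \<le> real n"
    using n by (metis of_nat_le_iff of_nat_numeral of_nat_power)
  then have "log 2 ((2::real) ^ 2 ^ 8) \<le> log 2 (real n)" by (intro log_mono) auto
  then have "2 ^ 8 \<le> log 2 (real n)" by (simp only: log_pow_cancel of_nat_power of_nat_numeral)
  then have "log 2 (2 ^ 8) \<le> L" unfolding L_def by (intro log_mono) auto
  then have "8 \<le> L" by (simp only: log_pow_cancel of_nat_numeral)
  moreover have "L \<le> real q + 4"
    unfolding L_def by (rule loglog_query_lower_bound[OF \<epsilon> A \<open>2 \<le> n\<close>])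
  ultimately have L: "L \<le> 2 * real q" "4 \<le> real q" by linarith+
  define M where "M = max 1 (log 2 (1 / \<epsilon>))"
  have "\<epsilon>\<^sup>2 * 1 \<le> \<epsilon>\<^sup>2 * M" unfolding M_def by (intro mult_left_mono) auto
  then have "1 / (\<epsilon>\<^sup>2 * M) \<le> 1 / \<epsilon>\<^sup>2" using \<epsilon> by (intro divide_left_mono) (auto simp: M_def)
  also have "1 / \<epsilon>\<^sup>2 \<le> 46080 * real q"
  proof (cases "\<epsilon> \<le> 1 / 100")
    case True
    then show ?thesis using eps_query_lower_bound \<epsilon> \<epsilon>n A by blast
  next
    \<comment> \<open>For large \<epsilon> the term is below 10000, and \<open>4 \<le> q\<close>
      from the first bound suffices.\<close>
    case False
    then have "(1 / 100)\<^sup>2 \<le> \<epsilon>\<^sup>2" by (intro power_mono) auto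
    then have "1 / \<epsilon>\<^sup>2 \<le> 1 / (1 / 100)\<^sup>2" using \<epsilon> by (intro divide_left_mono) auto
    then show ?thesis using L(2) by (simp add: power2_eq_square)
  qed
  finally show "1 / 100000 * query_bound n \<epsilon> \<le> real q"
    using L unfolding query_bound_def M_def L_def by simp
qed simp

end
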